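(* Let $r\geq 1$ be an integer, $n=2r+2$, and let $p\geq 3$ be a real number. For every $r$-regular graph $G$ of order $n$, $$\mathcal E_p(S(G))\leq (n-1)^p+(n-1).$$ Moreover, equality holds if and only if $G\cong K_{r+1}\cup K_{r+1}$.
   Context: All graphs are finite, simple, undirected, non-empty and have at least one edge (they need not be connected). The order of a graph is its number of vertices. A graph is $r$-regular if every vertex has degree $r$. $K_m$ denotes the complete graph on $m$ vertices, and $K_{r+1}\cup K_{r+1}$ is the disjoint union of two copies of $K_{r+1}$. For a graph $G$ with vertex set $\{v_1,\dots,v_n\}$, the Seidel matrix $S(G)$ is the real symmetric $n\times n$ matrix with zero diagonal whose $(i,j)$-entry, for $i\neq j$, is $-1$ if $v_i$ and $v_j$ are adjacent and $+1$ otherwise. If $\lambda_1,\dots,\lambda_n$ are the eigenvalues of $S(G)$ (with multiplicity), the $p$-Seidel energy is $\mathcal{E}_p(S(G))=\sum_{i=1}^n|\lambda_i|^p$ for $p>0$. *)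

theory Defs
  imports
    Complex_Main
    "HOL-Computational_Algebra.Polynomial"
    "Jordan_Normal_Form.Char_Poly"
    "Graph_Theory.Graph_Theory"
begin

(* Finite simple undirected graphs are the finite, loop-free, symmetric digraphs without parallel
   arcs (locale graph of Graph_Theory). An edge {u,v} is the pair of arcs u \<rightarrow> v and v \<rightarrow> u, so
   the degree of a vertex is its out-degree. *)

definition regular_graph :: "nat \<Rightarrow> ('a, 'b) pre_digraph \<Rightarrow> bool" where
  "regular_graph r G \<longleftrightarrow> (\<forall>v \<in> verts G. out_degree G v = r)"

definition complete_pgraph :: "'a set \<Rightarrow> 'a pair_pre_digraph" where
  "complete_pgraph V = \<lparr>pverts = V, parcs = {(u, v). u \<in> V \<and> v \<in> V \<and> u \<noteq> v}\<rparr>"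

lemma complete_digraph_complete_pgraph:
  "finite V \<Longrightarrow> complete_digraph (card V) (with_proj (complete_pgraph V))"
  by (auto simp: complete_digraph_pair_def complete_pgraph_def)

definition disjoint_pgraph_union ::
    "'a pair_pre_digraph \<Rightarrow> 'b pair_pre_digraph \<Rightarrow> ('a + 'b) pair_pre_digraph" where
  "disjoint_pgraph_union G H =
     \<lparr>pverts = pverts G <+> pverts H,
      parcs = map_prod Inl Inl ` parcs G \<union> map_prod Inr Inr ` parcs H\<rparr>"

(* The list vs is meant to enumerate the vertices of G without repetition. *)
definition seidel_mat :: "('a, 'b) pre_digraph \<Rightarrow> 'a list \<Rightarrow> real mat" where
  "seidel_mat G vs = mat (length vs) (length vs)
     (\<lambda>(i, j). if i = j then 0 else if vs ! i \<rightarrow>\<^bsub>G\<^esub> vs ! j then -1 else 1)"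

(* proots is the multiset of roots with multiplicity. A real symmetric n x n matrix has only real
   eigenvalues, so for such A the real roots of the characteristic polynomial already are all n
   eigenvalues. Since 0 powr p = 0, zero eigenvalues contribute nothing. *)
definition p_energy :: "real \<Rightarrow> real mat \<Rightarrow> real" where
  "p_energy p A = (\<Sum>x\<in>#proots (char_poly A). \<bar>x\<bar> powr p)"

end

theory Submission
  imports Defs "Jordan_Normal_Form.Schur_Decomposition" "HOL-Analysis.Convex"
begin

text \<open>Put \<open>M = n - 1 = 2 r + 1\<close>. The matrix \<open>S = S(G)\<close> has trace \<open>0\<close>, and all diagonal entries
  of \<open>S\<^sup>2\<close> equal \<open>n - 1\<close>, so its eigenvalues satisfy \<open>\<Sum>\<lambda> = 0\<close> and \<open>\<Sum>\<lambda>\<^sup>2 = M\<^sup>2 + M\<close>. Regularity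
  adds one more piece of information: \<open>S = J - I - 2A\<close> has constant row sum \<open>1\<close>, so an eigenvector for
  \<open>\<lambda> \<noteq> 1\<close> is orthogonal to the all-ones vector and is an eigenvector of \<open>A\<close>, whose eigenvalues lie in
  \<open>[-r, r]\<close>. Hence every \<open>\<lambda>\<close> lies in the asymmetric interval \<open>[-M, M - 2]\<close>
  (\<open>seidel_eigenvalue_range\<close>).

  These three facts already give the bound, by an argument about real numbers only. Consider \<open>p = 3\<close>
  first. If all \<open>\<bar>\<lambda>\<bar> \<le> M - 1\<close>, then \<open>\<Sum>\<bar>\<lambda>\<bar>\<^sup>3 \<le> (M - 1) \<Sum>\<lambda>\<^sup>2 < M\<^sup>3 + M\<close>. Otherwise the asymmetry of the
  interval forces an eigenvalue \<open>-c\<close> with \<open>c > M - 1\<close>. The other eigenvalues then have sum \<open>c\<close>, so that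
  their total squared deviation from \<open>1\<close> is only \<open>(M - c) (M + c + 2)\<close>; estimating each cube by its tangent at
  \<open>1\<close> plus \<open>M\<close> times the squared deviation yields \<open>\<Sum>\<bar>\<lambda>\<bar>\<^sup>3 \<le> M\<^sup>3 + M - (M - c) (c\<^sup>2 + 3 - 2 M)\<close>
  (\<open>abs_cube_sum_extremal\<close>). The last factor is positive, so equality forces \<open>c = M\<close>. For \<open>p \<ge> 3\<close> the
  function \<open>y\<^sup>p\<close> is majorised on \<open>[0, M]\<close> by a combination \<open>a y\<^sup>3 + b y\<^sup>2 + d\<close> with \<open>a > 0\<close> that agrees
  with it at \<open>1\<close> and at \<open>M\<close>, the absolute values occurring in the extremal spectrum
  (\<open>cubic_majorant_of_powr\<close>); summing reduces the claim to \<open>p = 3\<close> (\<open>power_sum_bound\<close>). Conversely, if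
  \<open>-M\<close> occurs, the squared deviation of the remaining eigenvalues vanishes, all of them are \<open>1\<close>, and
  equality holds.

  Thus equality holds exactly when \<open>-M\<close> is an eigenvalue. At an entry of maximal modulus, the
  eigenvalue equation \<open>S x = -M x\<close> is a tight triangle inequality. It forces \<open>x\<close> to have constant
  modulus and makes adjacency mean "equal sign", so \<open>G\<close> is a union of two cliques, which by regularity
  have \<open>r + 1\<close> vertices each; the sign vector of two cliques is conversely such an eigenvector.\<close>

section \<open>Power sums under first and second moment constraints\<close>

text \<open>Being tangent to \<open>y powr p\<close> at \<open>1\<close> and meeting it again at \<open>M\<close> determines \<open>a\<close>, \<open>b\<close>, \<open>d\<close>. The
  derivative of the difference \<open>g\<close> is \<open>y * h y\<close> with \<open>h\<close> convex, because \<open>y powr (p - 2)\<close> is convex for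
  \<open>p \<ge> 3\<close>. So \<open>h\<close> vanishes at \<open>1\<close> and, by Rolle, at some \<open>z\<close> between \<open>1\<close> and \<open>M\<close>; it is nonpositive
  between these zeros and nonnegative outside. Hence \<open>g\<close> rises (weakly) to \<open>0\<close> at \<open>1\<close>, falls until
  \<open>z\<close>, and rises to \<open>0\<close> at \<open>M\<close>.\<close>

lemma cubic_majorant_of_powr:
  fixes p M :: real
  assumes p: "p \<ge> 3" and M: "M > 1"
  obtains a b d where "a > 0" "a + b + d = 1" "a * M ^ 3 + b * M\<^sup>2 + d = M powr p"
    "\<And>y. 0 \<le> y \<Longrightarrow> y \<le> M \<Longrightarrow> y powr p \<le> a * y ^ 3 + b * y\<^sup>2 + d"
proof -
  \<comment> \<open>The denominator is \<open>M ^ 3 - 1 - 3 / 2 * (M\<^sup>2 - 1)\<close>, what remains of the coefficient of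
    \<open>a\<close> once tangency at \<open>1\<close> has eliminated \<open>b\<close> and \<open>d\<close>.\<close>
  define a where "a = (M powr p - 1 - p / 2 * (M\<^sup>2 - 1)) / ((M - 1)\<^sup>2 * (M + 1 / 2))"
  define b where "b = (p - 3 * a) / 2"
  define d where "d = 1 - a - b"
  define g where "g y = y powr p - (a * y ^ 3 + b * y\<^sup>2 + d)" for y
  define h where "h y = p * y powr (p - 2) - 3 * a * y - 2 * b" for y
  have g1: "g 1 = 0" by (simp add: g_def d_def)
  have h1: "h 1 = 0" by (simp add: h_def b_def)
  have "a * ((M - 1)\<^sup>2 * (M + 1 / 2)) = M powr p - 1 - p / 2 * (M\<^sup>2 - 1)"
    using M by (simp add: a_def)
  then have gM: "g M = 0"
    by (simp add: g_def d_def b_def power2_eq_square power3_eq_cube field_simps)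
  have deriv: "(g has_real_derivative y * h y) (at y)" if "y > 0" for y
  proof -
    have "y powr (p - 1) = y * y powr (p - 2)"
      using that powr_mult_base[of y "p - 2"] by (simp add: algebra_simps)
    then show ?thesis
      unfolding g_def h_def using that
      by (auto intro!: derivative_eq_intros simp: power2_eq_square algebra_simps)
  qed
  have cont: "continuous_on S g" if "S \<subseteq> {0..}" for S
    unfolding g_def using that p by (intro continuous_intros continuous_on_powr') auto
  have mvt: "\<exists>t. u < t \<and> t < v \<and> g v - g u = (v - u) * (t * h t)" if "0 \<le> u" "u < v" for u v
  proof -
    have "continuous_on {u..v} g" using cont that by auto
    moreover have "g differentiable (at x)" if "u < x" "x < v" for x
    proof -
      have "x > 0" using \<open>0 \<le> u\<close> that by linarith
      then show ?thesis using deriv[of x] real_differentiable_def by blast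
    qed
    ultimately obtain l t where t: "u < t" "t < v" "(g has_real_derivative l) (at t)"
        "g v - g u = (v - u) * l"
      using MVT[of u v g] \<open>u < v\<close> by blast
    have "t > 0" using t(1) that by linarith
    then have "l = t * h t" using DERIV_unique[OF t(3) deriv[of t]] by simp
    then show ?thesis using t by auto
  qed
  have conv: "(w - u) * h v \<le> (w - v) * h u + (v - u) * h w" if "0 < u" "u < v" "v < w" for u v w
  proof -
    define t where "t = (v - u) / (w - u)"
    have t: "0 \<le> t" "t \<le> 1" "(w - u) * t = v - u" using that by (auto simp: t_def field_simps)
    then have v: "v = (1 - t) *\<^sub>R u + t *\<^sub>R w" by (simp add: algebra_simps)
    have "convex_on {0<..} (\<lambda>x. x powr (p - 2))" using powr_convex p by simp
    then have "v powr (p - 2) \<le> (1 - t) * u powr (p - 2) + t * w powr (p - 2)"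
      using convex_onD[of "{0<..}" "\<lambda>x. x powr (p - 2)" t u w] t that unfolding v by simp
    then have "p * v powr (p - 2) \<le> p * ((1 - t) * u powr (p - 2) + t * w powr (p - 2))"
      using p by (intro mult_left_mono) auto
    then have "h v \<le> (1 - t) * h u + t * h w"
      by (simp add: h_def v algebra_simps)
    then have "(w - u) * h v \<le> (w - u) * ((1 - t) * h u + t * h w)"
      using that by (intro mult_left_mono) auto
    also have "\<dots> = ((w - u) - (w - u) * t) * h u + ((w - u) * t) * h w"
      by (simp add: algebra_simps)
    finally show ?thesis by (simp add: t(3))
  qed
  obtain z where z: "1 < z" "z < M" "h z = 0"
    using mvt[of 1 M] M g1 gM by auto
  have "h y \<ge> 0" if "0 < y" "y < 1" for y
    using conv[of y 1 z] that z h1 by (simp add: zero_le_mult_iff)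
  moreover have "h y \<le> 0" if "1 < y" "y < z" for y
    using conv[of 1 y z] that z h1 by (simp add: mult_le_0_iff)
  moreover have "h y \<ge> 0" if "z < y" for y
    using conv[of 1 z y] that z h1 by (simp add: zero_le_mult_iff)
  ultimately have sign: "\<And>y. 0 < y \<Longrightarrow> y < 1 \<Longrightarrow> y * h y \<ge> 0" "\<And>y. 1 < y \<Longrightarrow> y < z \<Longrightarrow> y * h y \<le> 0"
      "\<And>y. z < y \<Longrightarrow> y * h y \<ge> 0"
    using z by (auto simp: zero_le_mult_iff mult_le_0_iff)
  have "g y \<le> 0" if y: "0 \<le> y" "y \<le> M" for y
  proof -
    consider "y < 1" | "y = 1" | "1 < y" "y \<le> z" | "z < y" "y < M" | "y = M" using y by linarith
    then show ?thesis
    proof cases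
      case 1
      then obtain t where "y < t" "t < 1" "g 1 - g y = (1 - y) * (t * h t)" using mvt y by metis
      then show ?thesis using sign(1)[of t] y 1 g1
        by (smt (verit, ccfv_SIG) mult_nonneg_nonneg)
    next
      case 3
      then obtain t where "1 < t" "t < y" "g y - g 1 = (y - 1) * (t * h t)" using mvt[of 1 y] y by auto
      then show ?thesis using sign(2)[of t] 3 g1
        by (smt (verit, ccfv_SIG) mult_nonneg_nonpos)
    next
      case 4
      then obtain t where "y < t" "t < M" "g M - g y = (M - y) * (t * h t)" using mvt[of y M] y by auto
      then show ?thesis using sign(3)[of t] 4 gM
        by (smt (verit, ccfv_SIG) mult_nonneg_nonneg)
    qed (use g1 gM in auto)
  qed
  moreover have "a > 0"
  proof -
    have "1 < z powr (p - 2)" using z p by (simp add: gr_one_powr)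
    moreover have "3 * a * (z - 1) = p * (z powr (p - 2) - 1)"
      using z(3) h1 by (simp add: h_def algebra_simps)
    ultimately have "3 * a * (z - 1) > 0" using p by simp
    then show ?thesis using z by (simp add: zero_less_mult_iff)
  qed
  ultimately show ?thesis
    using gM by (intro that[of a b d]) (auto simp: g_def d_def)
qed

text \<open>The right side is the tangent of \<open>\<bar>m\<bar> ^ 3\<close> at \<open>1\<close> with a quadratic correction. For \<open>m \<ge> 0\<close> the
  exact correction factor is \<open>m + 2\<close>, which is where the bound \<open>m \<le> M - 2\<close> enters; for \<open>m = -k\<close> the
  factor \<open>max 3 k\<close> suffices.\<close>

lemma abs_cube_le:
  fixes m M :: real
  assumes "M \<ge> 3" "- M \<le> m" "m \<le> M - 2"
  shows "\<bar>m\<bar> ^ 3 \<le> 1 + 3 * (m - 1) + M * (m - 1)\<^sup>2"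
proof (cases "m \<ge> 0")
  case True
  have "m ^ 3 = 1 + 3 * (m - 1) + (m + 2) * (m - 1)\<^sup>2"
    by (simp add: power2_eq_square power3_eq_cube algebra_simps)
  also have "\<dots> \<le> 1 + 3 * (m - 1) + M * (m - 1)\<^sup>2"
    using assms by (intro add_left_mono mult_right_mono) auto
  finally show ?thesis using True by simp
next
  case False
  define k where "k = - m"
  have k: "k > 0" "k \<le> M" using False assms by (auto simp: k_def)
  have "k ^ 3 + 3 * k + 2 \<le> max 3 k * (k + 1)\<^sup>2"
  proof (cases "k \<le> 3")
    case True
    then have "k ^ 3 \<le> 3 * k\<^sup>2" using k by (simp add: power2_eq_square power3_eq_cube)
    moreover have "3 * (k + 1)\<^sup>2 = 3 * k\<^sup>2 + 6 * k + 3" by (simp add: power2_eq_square algebra_simps)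
    ultimately show ?thesis using True k by simp
  next
    case False
    then have "3 * k \<le> k\<^sup>2" by (simp add: power2_eq_square)
    moreover have "k * (k + 1)\<^sup>2 = k ^ 3 + 2 * k\<^sup>2 + k"
      by (simp add: power2_eq_square power3_eq_cube algebra_simps)
    ultimately show ?thesis using False by (simp add: max_def)
  qed
  also have "\<dots> \<le> M * (k + 1)\<^sup>2" using k assms by (intro mult_right_mono) auto
  finally show ?thesis using False by (simp add: k_def power2_eq_square algebra_simps)
qed

lemma sum_list_deviation_sq:
  fixes xs :: "real list"
  shows "(\<Sum>x\<leftarrow>xs. (x - 1)\<^sup>2) = (\<Sum>x\<leftarrow>xs. x\<^sup>2) - 2 * sum_list xs + length xs"
  by (induction xs) (auto simp: power2_eq_square algebra_simps)

lemma sum_list_cube_bound: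
  fixes xs :: "real list"
  assumes "\<And>x. x \<in> set xs \<Longrightarrow> \<bar>x\<bar> ^ 3 \<le> 1 + 3 * (x - 1) + M * (x - 1)\<^sup>2"
  shows "(\<Sum>x\<leftarrow>xs. \<bar>x\<bar> ^ 3) \<le> 3 * sum_list xs - 2 * length xs + M * (\<Sum>x\<leftarrow>xs. (x - 1)\<^sup>2)"
  using assms by (induction xs) (force simp: algebra_simps)+

text \<open>If all moduli are at most \<open>M - 1\<close>, replacing one factor of each cube by \<open>M - 1\<close> suffices.
  Otherwise some \<open>e = -c\<close> has \<open>c > M - 1\<close>. The remaining numbers sum to \<open>c\<close> and have sum of squares
  \<open>M\<^sup>2 + M - c\<^sup>2\<close>, hence total squared deviation \<open>(M - c) * (M + c + 2)\<close> from \<open>1\<close>. The gain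
  \<open>M ^ 3 - c ^ 3\<close>, together with \<open>3 * (M - c)\<close> from the tangents, exceeds \<open>M\<close> times this deviation by
  \<open>(M - c) * (c\<^sup>2 + 3 - 2 * M)\<close>, and \<open>c > M - 1\<close> makes the last factor positive.\<close>

lemma abs_cube_sum_extremal:
  fixes es :: "real list" and M :: real
  assumes M: "M \<ge> 3" and len: "length es = M + 1" and s1: "sum_list es = 0"
    and s2: "(\<Sum>e\<leftarrow>es. e\<^sup>2) = M\<^sup>2 + M"
    and range: "\<And>e. e \<in> set es \<Longrightarrow> - M \<le> e \<and> e \<le> M - 2"
  shows "(\<Sum>e\<leftarrow>es. \<bar>e\<bar> ^ 3) \<le> M ^ 3 + M"
    and "(\<Sum>e\<leftarrow>es. \<bar>e\<bar> ^ 3) = M ^ 3 + M \<Longrightarrow> - M \<in> set es"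
proof -
  have "(\<Sum>e\<leftarrow>es. \<bar>e\<bar> ^ 3) < M ^ 3 + M \<or> (\<Sum>e\<leftarrow>es. \<bar>e\<bar> ^ 3) \<le> M ^ 3 + M \<and> - M \<in> set es"
  proof (cases "\<forall>e \<in> set es. \<bar>e\<bar> \<le> M - 1")
    case True
    have "(\<Sum>e\<leftarrow>es. \<bar>e\<bar> ^ 3) \<le> (\<Sum>e\<leftarrow>es. (M - 1) * e\<^sup>2)"
    proof (intro sum_list_mono)
      fix e assume "e \<in> set es"
      then have "\<bar>e\<bar> * e\<^sup>2 \<le> (M - 1) * e\<^sup>2" using True by (intro mult_right_mono) auto
      then show "\<bar>e\<bar> ^ 3 \<le> (M - 1) * e\<^sup>2" by (simp add: power3_eq_cube power2_eq_square mult.assoc)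
    qed
    also have "\<dots> = (M - 1) * (M\<^sup>2 + M)" by (simp add: sum_list_const_mult s2)
    also have "\<dots> < M ^ 3 + M" using M by (simp add: power3_eq_cube power2_eq_square algebra_simps)
    finally show ?thesis by simp
  next
    case False
    then obtain e where e: "e \<in> set es" "\<bar>e\<bar> > M - 1" by auto
    \<comment> \<open>A positive \<open>e\<close> of this size is excluded by \<open>e \<le> M - 2\<close>.\<close>
    define c where "c = - e"
    have c: "M - 1 < c" "c \<le> M" using e range[of e] by (auto simp: c_def)
    define xs where "xs = remove1 e es"
    have perm: "mset es = mset (e # xs)" using e by (simp add: xs_def)
    have sums: "(\<Sum>x\<leftarrow>es. f x) = f e + (\<Sum>x\<leftarrow>xs. f x)" for f :: "real \<Rightarrow> real"
      using arg_cong[OF perm, of "\<lambda>m. sum_mset (image_mset f m)"] by (simp flip: sum_mset_sum_list)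
    have xs_len: "length xs = M" using len arg_cong[OF perm, of size] by simp
    have xs_s1: "sum_list xs = c" using sums[of "\<lambda>x. x"] s1 by (simp add: c_def)
    have xs_s2: "(\<Sum>x\<leftarrow>xs. x\<^sup>2) = M\<^sup>2 + M - c\<^sup>2" using sums[of "\<lambda>x. x\<^sup>2"] s2 by (simp add: c_def)
    have "set xs \<subseteq> set es" unfolding xs_def by (rule set_remove1_subset)
    then have "(\<Sum>x\<leftarrow>xs. \<bar>x\<bar> ^ 3) \<le> 3 * sum_list xs - 2 * length xs + M * (\<Sum>x\<leftarrow>xs. (x - 1)\<^sup>2)"
      using M range by (intro sum_list_cube_bound abs_cube_le) auto
    moreover have "\<bar>e\<bar> ^ 3 = c ^ 3" using c M by (simp add: c_def)
    ultimately have "(\<Sum>e\<leftarrow>es. \<bar>e\<bar> ^ 3)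
        \<le> c ^ 3 + (3 * c - 2 * M + M * (M\<^sup>2 + M - c\<^sup>2 - 2 * c + M))"
      using xs_len unfolding sums[of "\<lambda>x. \<bar>x\<bar> ^ 3"] sum_list_deviation_sq xs_s1 xs_s2 by simp
    then have "(\<Sum>e\<leftarrow>es. \<bar>e\<bar> ^ 3) \<le> M ^ 3 + M - (M - c) * (c\<^sup>2 + 3 - 2 * M)"
      by (simp add: power3_eq_cube power2_eq_square algebra_simps)
    moreover have "c\<^sup>2 + 3 - 2 * M > 0"
    proof -
      have "(M - 1)\<^sup>2 < c\<^sup>2" using c M by (intro power_strict_mono) auto
      moreover have "(M - 1)\<^sup>2 + 3 - 2 * M = (M - 2)\<^sup>2" by (simp add: power2_eq_square algebra_simps)
      ultimately show ?thesis using zero_le_power2[of "M - 2"] by linarith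
    qed
    ultimately have bound: "(\<Sum>e\<leftarrow>es. \<bar>e\<bar> ^ 3) \<le> M ^ 3 + M - (M - c) * (c\<^sup>2 + 3 - 2 * M)"
        and pos: "c\<^sup>2 + 3 - 2 * M > 0" by blast+
    show ?thesis
    proof (cases "c = M")
      case True
      then have "e = - M" by (simp add: c_def)
      then show ?thesis using bound e(1) True by simp
    next
      case False
      then have "(M - c) * (c\<^sup>2 + 3 - 2 * M) > 0" using c pos by simp
      then show ?thesis using bound by linarith
    qed
  qed
  then show "(\<Sum>e\<leftarrow>es. \<bar>e\<bar> ^ 3) \<le> M ^ 3 + M"
    and "(\<Sum>e\<leftarrow>es. \<bar>e\<bar> ^ 3) = M ^ 3 + M \<Longrightarrow> - M \<in> set es" by auto
qed

text \<open>Once \<open>-M\<close> is removed, the remaining \<open>M\<close> numbers have sum \<open>M\<close> and sum of squares \<open>M\<close>, so their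
  squared deviations from \<open>1\<close> add up to \<open>0\<close>.\<close>

lemma power_sum_eq_of_extreme:
  fixes es :: "real list" and M p :: real
  assumes M: "M \<ge> 0" and len: "length es = M + 1" and s1: "sum_list es = 0"
    and s2: "(\<Sum>e\<leftarrow>es. e\<^sup>2) = M\<^sup>2 + M" and e: "- M \<in> set es"
  shows "(\<Sum>e\<leftarrow>es. \<bar>e\<bar> powr p) = M powr p + M"
proof -
  define xs where "xs = remove1 (- M) es"
  have perm: "mset es = mset (- M # xs)" using e by (simp add: xs_def)
  have sums: "(\<Sum>x\<leftarrow>es. f x) = f (- M) + (\<Sum>x\<leftarrow>xs. f x)" for f :: "real \<Rightarrow> real"
    using arg_cong[OF perm, of "\<lambda>m. sum_mset (image_mset f m)"] by (simp flip: sum_mset_sum_list)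
  have xs_len: "length xs = M" using len arg_cong[OF perm, of size] by simp
  have "(\<Sum>x\<leftarrow>xs. (x - 1)\<^sup>2) = 0"
    using sums[of "\<lambda>x. x"] sums[of "\<lambda>x. x\<^sup>2"] s1 s2 xs_len by (simp add: sum_list_deviation_sq)
  then have ones: "x = 1" if "x \<in> set xs" for x
    using that by (subst (asm) sum_list_nonneg_eq_0_iff) auto
  have "(\<Sum>x\<leftarrow>xs. \<bar>x\<bar> powr p) = (\<Sum>x\<leftarrow>xs. 1)"
    by (intro arg_cong[where f = sum_list] map_cong refl) (auto dest: ones)
  then show ?thesis using M by (simp add: sums sum_list_triv xs_len)
qed

text \<open>Summing the cubic majorant turns the deficit of the cube sum, multiplied by \<open>a > 0\<close>, into a deficit
  of the \<open>p\<close>-th power sum; equality can only come from equality for cubes.\<close>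

lemma power_sum_bound:
  fixes es :: "real list" and M p :: real
  assumes p: "p \<ge> 3" and M: "M \<ge> 3" and len: "length es = M + 1" and s1: "sum_list es = 0"
    and s2: "(\<Sum>e\<leftarrow>es. e\<^sup>2) = M\<^sup>2 + M"
    and range: "\<And>e. e \<in> set es \<Longrightarrow> - M \<le> e \<and> e \<le> M - 2"
  shows "(\<Sum>e\<leftarrow>es. \<bar>e\<bar> powr p) \<le> M powr p + M"
    and "(\<Sum>e\<leftarrow>es. \<bar>e\<bar> powr p) = M powr p + M \<longleftrightarrow> - M \<in> set es"
proof -
  obtain a b d where a: "a > 0" and 1: "a + b + d = 1" and at_M: "a * M ^ 3 + b * M\<^sup>2 + d = M powr p"
    and le: "\<And>y. 0 \<le> y \<Longrightarrow> y \<le> M \<Longrightarrow> y powr p \<le> a * y ^ 3 + b * y\<^sup>2 + d"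
    using cubic_majorant_of_powr[of p M] p M by auto
  have "(\<Sum>e\<leftarrow>es. \<bar>e\<bar> powr p) \<le> (\<Sum>e\<leftarrow>es. a * \<bar>e\<bar> ^ 3 + b * e\<^sup>2 + d)"
    using le[of "\<bar>e\<bar>" for e] range by (intro sum_list_mono) (force simp: abs_le_iff)
  also have "\<dots> = a * (\<Sum>e\<leftarrow>es. \<bar>e\<bar> ^ 3) + b * (M\<^sup>2 + M) + d * (M + 1)"
    by (simp add: sum_list_addf sum_list_const_mult s2 sum_list_triv len)
  also have "\<dots> = M powr p + M - a * (M ^ 3 + M - (\<Sum>e\<leftarrow>es. \<bar>e\<bar> ^ 3))"
  proof -
    have "b * (M\<^sup>2 + M) + d * (M + 1) = (a * M ^ 3 + b * M\<^sup>2 + d) + (a + b + d) * M - a * (M ^ 3 + M)"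
      by (simp add: algebra_simps)
    then show ?thesis unfolding 1 at_M by (simp add: algebra_simps)
  qed
  finally have bound: "(\<Sum>e\<leftarrow>es. \<bar>e\<bar> powr p) \<le> M powr p + M - a * (M ^ 3 + M - (\<Sum>e\<leftarrow>es. \<bar>e\<bar> ^ 3))" .
  note cube = abs_cube_sum_extremal[OF M len s1 s2 range]
  have "0 \<le> a * (M ^ 3 + M - (\<Sum>e\<leftarrow>es. \<bar>e\<bar> ^ 3))" using a cube(1) by simp
  then show "(\<Sum>e\<leftarrow>es. \<bar>e\<bar> powr p) \<le> M powr p + M" using bound by linarith
  show "(\<Sum>e\<leftarrow>es. \<bar>e\<bar> powr p) = M powr p + M \<longleftrightarrow> - M \<in> set es"
  proof
    assume "(\<Sum>e\<leftarrow>es. \<bar>e\<bar> powr p) = M powr p + M"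
    then have "a * (M ^ 3 + M - (\<Sum>e\<leftarrow>es. \<bar>e\<bar> ^ 3)) \<le> 0" using bound by linarith
    then have "(\<Sum>e\<leftarrow>es. \<bar>e\<bar> ^ 3) = M ^ 3 + M" using a cube(1) by (simp add: mult_le_0_iff)
    then show "- M \<in> set es" using cube(2) by blast
  next
    assume "- M \<in> set es"
    then show "(\<Sum>e\<leftarrow>es. \<bar>e\<bar> powr p) = M powr p + M"
      using power_sum_eq_of_extreme[OF _ len s1 s2] M by simp
  qed
qed

section \<open>Traces and eigenvalues of real symmetric matrices\<close>

definition mat_trace :: "'a :: comm_monoid_add mat \<Rightarrow> 'a" where
  "mat_trace A = (\<Sum>i<dim_row A. A $$ (i, i))"

lemma index_mult_mat_sum:
  assumes "A \<in> carrier_mat n m" "B \<in> carrier_mat m k" "i < n" "j < k"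
  shows "(A * B) $$ (i, j) = (\<Sum>l<m. A $$ (i, l) * B $$ (l, j))"
  using assms by (simp add: scalar_prod_def atLeast0LessThan)

lemma mat_trace_mult_commute:
  fixes A B :: "'a :: comm_semiring_0 mat"
  assumes A: "A \<in> carrier_mat n m" and B: "B \<in> carrier_mat m n"
  shows "mat_trace (A * B) = mat_trace (B * A)"
proof -
  have "mat_trace (A * B) = (\<Sum>i<n. \<Sum>l<m. A $$ (i, l) * B $$ (l, i))"
    unfolding mat_trace_def using A B
    by (intro sum.cong) (auto simp: index_mult_mat_sum[OF A B] simp del: index_mult_mat(1))
  also have "\<dots> = (\<Sum>l<m. \<Sum>i<n. B $$ (l, i) * A $$ (i, l))"
    by (subst sum.swap) (simp add: mult.commute)
  also have "\<dots> = mat_trace (B * A)"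
    unfolding mat_trace_def using A B
    by (intro sum.cong) (auto simp: index_mult_mat_sum[OF B A] simp del: index_mult_mat(1))
  finally show ?thesis .
qed

lemma mat_trace_similar:
  fixes A B :: "'a :: comm_ring_1 mat"
  assumes "similar_mat_wit A B P Q"
  shows "mat_trace A = mat_trace B"
proof -
  define n where "n = dim_row A"
  note wit = similar_mat_witD[OF n_def assms]
  have "mat_trace A = mat_trace (P * (B * Q))" using wit by (simp add: assoc_mult_mat[of _ n n _ n _ n])
  also have "\<dots> = mat_trace (B * Q * P)" using wit by (intro mat_trace_mult_commute) auto
  also have "B * Q * P = B" using wit by (simp add: assoc_mult_mat[of _ n n _ n _ n])
  finally show ?thesis .
qed

lemma upper_triangular_square_diag:
  fixes B :: "'a :: comm_semiring_1 mat"
  assumes B: "B \<in> carrier_mat n n" and ut: "upper_triangular B" and i: "i < n"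
  shows "(B * B) $$ (i, i) = (B $$ (i, i))\<^sup>2"
proof -
  have "B $$ (i, l) * B $$ (l, i) = 0" if "l < n" "l \<noteq> i" for l
    using that i B ut by (cases "l < i") (auto simp: upper_triangularD)
  then have "(\<Sum>l<n. B $$ (i, l) * B $$ (l, i)) = (\<Sum>l<n. if l = i then (B $$ (i, i))\<^sup>2 else 0)"
    by (intro sum.cong) (auto simp: power2_eq_square)
  then show ?thesis using i by (simp add: index_mult_mat_sum[OF B B i i] del: index_mult_mat(1))
qed

text \<open>Both sides are invariant under similarity and can be read off the diagonal of a Schur form.\<close>

lemma trace_eq_sum_eigenvalues:
  fixes A :: "'a :: conjugatable_ordered_field mat"
  assumes A: "A \<in> carrier_mat n n" and split: "char_poly A = (\<Prod>e\<leftarrow>es. [:- e, 1:])"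
  shows "mat_trace A = sum_list es" and "mat_trace (A * A) = (\<Sum>e\<leftarrow>es. e\<^sup>2)"
proof -
  obtain B P Q where "schur_decomposition A es = (B, P, Q)" by (metis prod_cases3)
  note schur = schur_decomposition[OF A split this]
  then have wit: "similar_mat_wit A B P Q" and ut: "upper_triangular B" and diag: "diag_mat B = es"
    by auto
  have B: "B \<in> carrier_mat n n" using similar_mat_witD2[OF A wit] by simp
  have es: "(\<Sum>e\<leftarrow>es. f e) = (\<Sum>i<n. f (B $$ (i, i)))" for f :: "'a \<Rightarrow> 'a"
    using B by (simp add: diag[symmetric] diag_mat_def comp_def interv_sum_list_conv_sum_set_nat
        atLeast0LessThan)
  show "mat_trace A = sum_list es"
    unfolding mat_trace_similar[OF wit] using es[of "\<lambda>e. e"] B by (simp add: mat_trace_def)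
  have "similar_mat_wit (A * A) (B * B) P Q"
    using similar_mat_wit_pow[OF wit, of 2] A B by (simp add: numeral_2_eq_2)
  from mat_trace_similar[OF this] show "mat_trace (A * A) = (\<Sum>e\<leftarrow>es. e\<^sup>2)"
    unfolding es mat_trace_def using B
    by (simp add: upper_triangular_square_diag[OF B ut] del: index_mult_mat(1))
qed

text \<open>Writing vectors as functions on indices lets the eigenvalue equation be moved from positions in a
  vertex list to the vertices themselves.\<close>

lemma eigenvalue_sum_form:
  fixes A :: "'a :: field mat"
  assumes A: "A \<in> carrier_mat n n"
  shows "eigenvalue A k \<longleftrightarrow>
    (\<exists>x. (\<exists>i<n. x i \<noteq> 0) \<and> (\<forall>i<n. (\<Sum>j<n. A $$ (i, j) * x j) = k * x i))"
proof
  assume "eigenvalue A k"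
  then obtain v where v: "v \<in> carrier_vec n" "v \<noteq> 0\<^sub>v n" "A *\<^sub>v v = k \<cdot>\<^sub>v v"
    using A by (auto simp: eigenvalue_def eigenvector_def)
  have "\<exists>i<n. v $ i \<noteq> 0" using v(1,2) by (auto simp: vec_eq_iff)
  moreover have "(\<Sum>j<n. A $$ (i, j) * v $ j) = k * v $ i" if "i < n" for i
    using arg_cong[OF v(3), of "\<lambda>w. w $ i"] that A v(1)
    by (simp add: scalar_prod_def atLeast0LessThan)
  ultimately show "\<exists>x. (\<exists>i<n. x i \<noteq> 0) \<and> (\<forall>i<n. (\<Sum>j<n. A $$ (i, j) * x j) = k * x i)"
    by (intro exI[of _ "\<lambda>i. v $ i"]) auto
next
  assume "\<exists>x. (\<exists>i<n. x i \<noteq> 0) \<and> (\<forall>i<n. (\<Sum>j<n. A $$ (i, j) * x j) = k * x i)"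
  then obtain x where x: "\<exists>i<n. x i \<noteq> 0" "\<And>i. i < n \<Longrightarrow> (\<Sum>j<n. A $$ (i, j) * x j) = k * x i"
    by auto
  have "A *\<^sub>v vec n x = k \<cdot>\<^sub>v vec n x"
    using A x(2) by (intro eq_vecI) (auto simp: scalar_prod_def atLeast0LessThan)
  moreover have "vec n x \<noteq> 0\<^sub>v n" using x(1) by (auto simp: vec_eq_iff)
  ultimately show "eigenvalue A k"
    using A by (auto simp: eigenvalue_def eigenvector_def intro!: exI[of _ "vec n x"])
qed

text \<open>The Rayleigh quotient \<open>q / N\<close> of an eigenvector equals the eigenvalue, and \<open>q\<close> is its own
  conjugate.\<close>

lemma hermitian_eigenvalue_real:
  fixes C :: "complex mat"
  assumes C: "C \<in> carrier_mat n n" and herm: "\<And>i j. i < n \<Longrightarrow> j < n \<Longrightarrow> C $$ (j, i) = cnj (C $$ (i, j))"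
    and ev: "eigenvalue C a"
  shows "a \<in> \<real>"
proof -
  obtain x where x: "\<exists>i<n. x i \<noteq> 0" "\<And>i. i < n \<Longrightarrow> (\<Sum>j<n. C $$ (i, j) * x j) = a * x i"
    using ev eigenvalue_sum_form[OF C] by auto
  define q where "q = (\<Sum>i<n. \<Sum>j<n. cnj (x i) * C $$ (i, j) * x j)"
  define N where "N = (\<Sum>i<n. (cmod (x i))\<^sup>2)"
  have "cnj (cnj (x i) * C $$ (i, j) * x j) = cnj (x j) * C $$ (j, i) * x i"
    if "i < n" "j < n" for i j using herm[OF that] by simp
  then have "cnj q = (\<Sum>i<n. \<Sum>j<n. cnj (x j) * C $$ (j, i) * x i)"
    unfolding q_def cnj_sum by (intro sum.cong refl) blast
  also have "\<dots> = q" unfolding q_def by (rule sum.swap)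
  finally have "q \<in> \<real>" using Reals_cnj_iff by blast
  moreover have "q = a * of_real N"
  proof -
    have "q = (\<Sum>i<n. cnj (x i) * (a * x i))"
      unfolding q_def by (intro sum.cong refl) (simp add: x(2)[symmetric] sum_distrib_left mult.assoc)
    then show ?thesis
      by (simp add: N_def sum_distrib_left complex_norm_square mult_ac del: of_real_power)
  qed
  moreover have "N > 0"
  proof -
    obtain i where "i < n" "x i \<noteq> 0" using x(1) by auto
    then show ?thesis unfolding N_def by (intro sum_pos2[of _ i]) auto
  qed
  ultimately have "a = q / of_real N" by simp
  then show ?thesis using \<open>q \<in> \<real>\<close> by simp
qed

text \<open>Over the complex numbers the characteristic polynomial splits, and its roots are real, so the
  factorisation descends to the reals. The equality of the two real polynomials is checked pointwise.\<close>

lemma symmetric_real_char_poly_splits: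
  fixes A :: "real mat"
  assumes A: "A \<in> carrier_mat n n" and sym: "\<And>i j. i < n \<Longrightarrow> j < n \<Longrightarrow> A $$ (j, i) = A $$ (i, j)"
  obtains es where "char_poly A = (\<Prod>e\<leftarrow>es. [:- e, 1:])" "length es = n"
proof -
  define C :: "complex mat" where "C = map_mat of_real A"
  have C: "C \<in> carrier_mat n n" using A by (simp add: C_def)
  obtain as where as: "char_poly C = (\<Prod>a\<leftarrow>as. [:- a, 1:])" "length as = n"
    using char_poly_factorized[OF C] by auto
  have "a \<in> \<real>" if "a \<in> set as" for a
  proof (rule hermitian_eigenvalue_real[OF C])
    show "C $$ (j, i) = cnj (C $$ (i, j))" if "i < n" "j < n" for i j
      using that A sym by (simp add: C_def)
    show "eigenvalue C a"
      using that eigenvalue_root_char_poly[OF C] as(1) by (auto simp: poly_prod_list prod_list_zero_iff)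
  qed
  then have real: "of_real (Re a) = a" if "a \<in> set as" for a using that by simp
  define es where "es = map Re as"
  have "char_poly A = (\<Prod>e\<leftarrow>es. [:- e, 1:])"
  proof -
    have "poly (char_poly A) t = poly (\<Prod>e\<leftarrow>es. [:- e, 1:]) t" for t
    proof -
      have "complex_of_real (poly (char_poly A) t) = poly (char_poly C) (of_real t)"
        unfolding C_def of_real_hom.char_poly_hom[OF A] by simp
      also have "\<dots> = (\<Prod>a\<leftarrow>as. of_real (t - Re a))"
        unfolding as(1) poly_prod_list map_map
        by (intro arg_cong[where f = prod_list] map_cong refl) (use real in simp)
      also have "\<dots> = of_real (poly (\<Prod>e\<leftarrow>es. [:- e, 1:]) t)"
        by (simp add: es_def poly_prod_list of_real_hom.hom_prod_list comp_def)
      finally show ?thesis by (simp only: of_real_eq_iff)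
    qed
    then show ?thesis by (metis poly_eq_poly_eq_iff ext)
  qed
  moreover have "length es = n" using as(2) by (simp add: es_def)
  ultimately show ?thesis using that by blast
qed

lemma p_energy_split:
  assumes "char_poly A = (\<Prod>e\<leftarrow>es. [:- e, 1:])"
  shows "p_energy p A = (\<Sum>e\<leftarrow>es. \<bar>e\<bar> powr p)"
proof -
  have "proots (char_poly A) = mset es"
    unfolding assms
  proof (induction es)
    case (Cons e es)
    have "proots ([:- e, 1:] * (\<Prod>e\<leftarrow>es. [:- e, 1:])) = add_mset e (mset es)"
      by (subst proots_mult) (use Cons in \<open>auto simp: prod_list_zero_iff\<close>)
    then show ?case by (simp only: list.map prod_list.Cons mset.simps)
  qed simp
  then show ?thesis by (simp add: p_energy_def flip: sum_mset_sum_list)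
qed

section \<open>Eigenvectors of the Seidel matrix of a regular graph\<close>

definition seidel_sign :: "('v \<Rightarrow> 'v \<Rightarrow> bool) \<Rightarrow> 'v \<Rightarrow> 'v \<Rightarrow> real" where
  "seidel_sign adj u v = (if u = v then 0 else if adj u v then -1 else 1)"

definition two_cliques :: "'v set \<Rightarrow> ('v \<Rightarrow> 'v \<Rightarrow> bool) \<Rightarrow> nat \<Rightarrow> bool" where
  "two_cliques V adj k \<longleftrightarrow> (\<exists>X \<subseteq> V. card X = k \<and> card (V - X) = k \<and>
     (\<forall>u\<in>V. \<forall>v\<in>V. adj u v \<longleftrightarrow> u \<noteq> v \<and> (u \<in> X \<longleftrightarrow> v \<in> X)))"

definition seidel_eigenvector :: "'v set \<Rightarrow> ('v \<Rightarrow> 'v \<Rightarrow> bool) \<Rightarrow> real \<Rightarrow> ('v \<Rightarrow> real) \<Rightarrow> bool" where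
  "seidel_eigenvector V adj k x \<longleftrightarrow> (\<exists>v\<in>V. x v \<noteq> 0) \<and>
     (\<forall>u\<in>V. (\<Sum>v\<in>V. seidel_sign adj u v * x v) = k * x u)"

text \<open>The spectral arguments need only the adjacency relation of a regular graph on its vertex set, free
  of arcs and of any enumeration of the vertices.\<close>

locale regular_relation =
  fixes V :: "'v set" and adj :: "'v \<Rightarrow> 'v \<Rightarrow> bool" and r :: nat
  assumes finite_V: "finite V"
    and adj_sym: "\<And>u v. adj u v \<Longrightarrow> adj v u"
    and adj_irrefl: "\<And>v. \<not> adj v v"
    and degree: "\<And>v. v \<in> V \<Longrightarrow> card {w \<in> V. adj v w} = r"
begin

text \<open>This is \<open>S = J - I - 2A\<close>, applied to \<open>x\<close> and read off at \<open>u\<close>.\<close>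

lemma seidel_row_sum:
  assumes u: "u \<in> V"
  shows "(\<Sum>v\<in>V. seidel_sign adj u v * x v) = sum x V - x u - 2 * (\<Sum>v | v \<in> V \<and> adj u v. x v)"
proof -
  have "(\<Sum>v\<in>V. seidel_sign adj u v * x v)
      = (\<Sum>v\<in>V. x v - (if v = u then x u else 0) - (if adj u v then 2 * x v else 0))"
    using adj_irrefl by (intro sum.cong) (auto simp: seidel_sign_def)
  also have "\<dots> = sum x V - x u - (\<Sum>v\<in>V. if adj u v then 2 * x v else 0)"
    using u finite_V by (simp add: sum_subtractf)
  also have "(\<Sum>v\<in>V. if adj u v then 2 * x v else 0) = 2 * (\<Sum>v | v \<in> V \<and> adj u v. x v)"
    using finite_V by (simp add: sum.If_cases sum_distrib_left Int_def)
  finally show ?thesis .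
qed

lemma obtain_max_entry:
  assumes "v \<in> V"
  obtains u where "u \<in> V" "\<And>w. w \<in> V \<Longrightarrow> \<bar>x w\<bar> \<le> \<bar>x u :: real\<bar>"
proof -
  have "Max ((\<lambda>w. \<bar>x w\<bar>) ` V) \<in> (\<lambda>w. \<bar>x w\<bar>) ` V" using finite_V assms by (intro Max_in) auto
  then obtain u where "u \<in> V" "Max ((\<lambda>w. \<bar>x w\<bar>) ` V) = \<bar>x u\<bar>" by auto
  then show ?thesis using that[of u] Max_ge[of "(\<lambda>w. \<bar>x w\<bar>) ` V"] finite_V by auto
qed

text \<open>By regularity and \<open>card V = 2 * r + 2\<close>, the all-ones vector is an eigenvector for \<open>1\<close>; eigenvectors
  of a symmetric matrix for different eigenvalues are orthogonal.\<close>

lemma eigenvector_orthogonal_ones: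
  assumes card: "card V = 2 * r + 2" and ev: "seidel_eigenvector V adj k x" and k: "k \<noteq> 1"
  shows "sum x V = 0"
proof -
  have row: "(\<Sum>v\<in>V. seidel_sign adj u v) = 1" if "u \<in> V" for u
    using seidel_row_sum[OF that, of "\<lambda>_. 1"] degree[OF that] card by simp
  have "k * sum x V = (\<Sum>u\<in>V. \<Sum>v\<in>V. seidel_sign adj u v * x v)"
    using ev by (simp add: seidel_eigenvector_def sum_distrib_left)
  also have "\<dots> = (\<Sum>v\<in>V. (\<Sum>u\<in>V. seidel_sign adj v u) * x v)"
    by (subst sum.swap) (auto simp: sum_distrib_right seidel_sign_def intro!: sum.cong dest: adj_sym)
  also have "\<dots> = sum x V" using row by simp
  finally show ?thesis using k by (simp add: algebra_simps)
qed

text \<open>On the orthogonal complement of the all-ones vector, \<open>S x = k x\<close> says \<open>-2 A x = (k + 1) x\<close>. At an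
  entry of maximal modulus, the \<open>r\<close> neighbours give \<open>\<bar>k + 1\<bar> \<le> 2 r\<close>.\<close>

lemma seidel_eigenvalue_range:
  assumes r: "r \<ge> 1" and card: "card V = 2 * r + 2" and ev: "seidel_eigenvector V adj k x"
  shows "- (2 * real r + 1) \<le> k \<and> k \<le> 2 * real r - 1"
proof (cases "k = 1")
  case True
  then show ?thesis using r by simp
next
  case False
  obtain v where v: "v \<in> V" "x v \<noteq> 0" using ev by (auto simp: seidel_eigenvector_def)
  obtain u where u: "u \<in> V" "\<And>w. w \<in> V \<Longrightarrow> \<bar>x w\<bar> \<le> \<bar>x u\<bar>" using obtain_max_entry[OF v(1)] by blast
  have "k * x u = - x u - 2 * (\<Sum>v | v \<in> V \<and> adj u v. x v)"
    using ev u(1) seidel_row_sum[OF u(1), of x] eigenvector_orthogonal_ones[OF card ev False]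
    by (simp add: seidel_eigenvector_def)
  then have "\<bar>k + 1\<bar> * \<bar>x u\<bar> = 2 * \<bar>\<Sum>v | v \<in> V \<and> adj u v. x v\<bar>"
    by (simp flip: abs_mult add: algebra_simps)
  also have "\<bar>\<Sum>v | v \<in> V \<and> adj u v. x v\<bar> \<le> (\<Sum>v | v \<in> V \<and> adj u v. \<bar>x u\<bar>)"
    using u(2) by (intro order.trans[OF sum_abs] sum_mono) auto
  also have "(\<Sum>v | v \<in> V \<and> adj u v. \<bar>x u\<bar>) = r * \<bar>x u\<bar>" using degree[OF u(1)] by simp
  finally have "\<bar>k + 1\<bar> * \<bar>x u\<bar> \<le> (2 * r) * \<bar>x u\<bar>" by simp
  moreover have "\<bar>x u\<bar> > 0" using u(2)[OF v(1)] v(2) by linarith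
  ultimately have "\<bar>k + 1\<bar> \<le> 2 * r" by simp
  then show ?thesis by linarith
qed

text \<open>At a vertex \<open>u\<close> with \<open>\<bar>x u\<bar> = c\<close> maximal, the \<open>2 r + 1\<close> off-diagonal terms of the equation
  multiplied by \<open>x u\<close> are each at least \<open>-c\<^sup>2\<close>, but their sum is \<open>-(2 r + 1) c\<^sup>2\<close>; so each of them is
  \<open>-c\<^sup>2\<close>. Then every entry has modulus \<open>c\<close>, so this applies at every vertex, and the sign of each matrix
  entry is determined by the signs of \<open>x\<close>.\<close>

lemma extreme_eigenvector_imp_two_cliques:
  assumes card: "card V = 2 * r + 2" and ev: "seidel_eigenvector V adj (- (2 * real r + 1)) x"
  shows "two_cliques V adj (r + 1)"
proof -
  obtain v where v: "v \<in> V" "x v \<noteq> 0" using ev by (auto simp: seidel_eigenvector_def)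
  obtain m where m: "m \<in> V" "\<And>w. w \<in> V \<Longrightarrow> \<bar>x w\<bar> \<le> \<bar>x m\<bar>" using obtain_max_entry[OF v(1)] by blast
  define c where "c = \<bar>x m\<bar>"
  have c: "c > 0" "\<And>w. w \<in> V \<Longrightarrow> \<bar>x w\<bar> \<le> c" using m v by (force simp: c_def)+
  have tight: "seidel_sign adj u w * x w * x u = - c\<^sup>2"
    if u: "u \<in> V" "\<bar>x u\<bar> = c" and w: "w \<in> V" "w \<noteq> u" for u w
  proof -
    have "(\<Sum>w\<in>V - {u}. seidel_sign adj u w * x w * x u) = (\<Sum>w\<in>V. seidel_sign adj u w * x w) * x u"
      using finite_V u(1) by (simp add: sum_diff1 sum_distrib_right seidel_sign_def)
    also have "\<dots> = - (2 * real r + 1) * (x u)\<^sup>2"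
      using ev u(1) by (simp add: seidel_eigenvector_def power2_eq_square)
    also have "(x u)\<^sup>2 = c\<^sup>2" using u(2) by (metis power2_abs)
    finally have total: "(\<Sum>w\<in>V - {u}. c\<^sup>2 + seidel_sign adj u w * x w * x u) = 0"
      using finite_V u(1) card by (simp add: sum.distrib algebra_simps)
    have "c\<^sup>2 + seidel_sign adj u w * x w * x u \<ge> 0" if "w \<in> V" for w
    proof -
      have "\<bar>seidel_sign adj u w\<bar> * \<bar>x w\<bar> \<le> 1 * c"
        using c(2)[OF that] by (intro mult_mono) (auto simp: seidel_sign_def)
      then have "\<bar>seidel_sign adj u w * x w * x u\<bar> \<le> c\<^sup>2"
        using u(2) c(1) by (simp add: abs_mult power2_eq_square)
      then show ?thesis by linarith
    qed
    then have "\<forall>w\<in>V - {u}. c\<^sup>2 + seidel_sign adj u w * x w * x u = 0"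
      using total finite_V by (subst (asm) sum_nonneg_eq_0_iff) auto
    then show ?thesis using w by force
  qed
  have const: "\<bar>x w\<bar> = c" if "w \<in> V" for w
  proof (cases "w = m")
    case False
    then have "\<bar>seidel_sign adj m w * x w * x m\<bar> = c\<^sup>2"
      using tight[of m w] m(1) that by (simp add: c_def)
    then show ?thesis
      using False c(1) by (auto simp: seidel_sign_def abs_mult power2_eq_square c_def[symmetric])
  qed (simp add: c_def)
  define X where "X = {v \<in> V. x v = c}"
  have X: "X \<subseteq> V" by (auto simp: X_def)
  have adj: "adj u w \<longleftrightarrow> u \<noteq> w \<and> (u \<in> X \<longleftrightarrow> w \<in> X)" if "u \<in> V" "w \<in> V" for u w
  proof (cases "u = w")
    case False
    have "x u = c \<or> x u = - c" "x w = c \<or> x w = - c" using const that by fastforce+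
    moreover have "c\<^sup>2 > 0" "- c \<noteq> c" using c(1) by auto
    ultimately show ?thesis
      using tight[of u w] const that False
      by (auto simp: X_def seidel_sign_def power2_eq_square split: if_splits)
  qed (simp add: adj_irrefl)
  have class_size: "card Y = r + 1"
    if "u \<in> Y" "Y \<subseteq> V" "\<And>w. w \<in> V \<Longrightarrow> adj u w \<longleftrightarrow> u \<noteq> w \<and> w \<in> Y" for u Y
  proof -
    have "{w \<in> V. adj u w} = Y - {u}" using that by auto
    then have "card (Y - {u}) = r" using degree[of u] that(1,2) by auto
    moreover have "finite Y" using that(2) finite_V finite_subset by blast
    ultimately show ?thesis using card.remove[of Y u] that(1) by (metis Suc_eq_plus1)
  qed
  have both: "card X + card (V - X) = 2 * r + 2"
    using X finite_V card card_mono[OF finite_V X] by (simp add: card_Diff_subset finite_subset)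
  \<comment> \<open>If one sign were absent, \<open>V\<close> would be a single clique of \<open>r + 1\<close> vertices, too few.\<close>
  have "card X = r + 1 \<and> card (V - X) = r + 1"
  proof (cases "X = {}")
    case True
    then have "card V = r + 1" using class_size[of m V] adj m(1) by auto
    then show ?thesis using card by simp
  next
    case False
    then obtain u where "u \<in> X" by auto
    then have "card X = r + 1" using class_size[of u X] adj X by auto
    then show ?thesis using both by simp
  qed
  then show ?thesis using X adj by (auto simp: two_cliques_def)
qed

lemma two_cliques_imp_extreme_eigenvector:
  assumes card: "card V = 2 * r + 2" and two: "two_cliques V adj k"
  shows "\<exists>x. seidel_eigenvector V adj (- (2 * real r + 1)) x"
proof -
  obtain X where adj: "\<forall>u\<in>V. \<forall>v\<in>V. adj u v \<longleftrightarrow> u \<noteq> v \<and> (u \<in> X \<longleftrightarrow> v \<in> X)"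
    using two unfolding two_cliques_def by blast
  define x :: "'v \<Rightarrow> real" where "x v = (if v \<in> X then 1 else -1)" for v
  have "(\<Sum>v\<in>V. seidel_sign adj u v * x v) = - (2 * real r + 1) * x u" if u: "u \<in> V" for u
  proof -
    have "(\<Sum>v\<in>V. seidel_sign adj u v * x v) = (\<Sum>v\<in>V. (if v = u then x u else 0) - x u)"
      using u adj by (intro sum.cong) (auto simp: seidel_sign_def x_def)
    then show ?thesis using u finite_V card by (simp add: sum_subtractf algebra_simps)
  qed
  moreover have "V \<noteq> {}" using card by auto
  ultimately show ?thesis by (intro exI[of _ x]) (auto simp: seidel_eigenvector_def x_def)
qed

end

section \<open>Graphs consisting of two cliques\<close>

lemma regular_relation_graph:
  assumes "graph G" "regular_graph r G"
  shows "regular_relation (verts G) (\<lambda>u v. u \<rightarrow>\<^bsub>G\<^esub> v) r"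
proof -
  interpret graph G by fact
  show ?thesis
  proof
    show "finite (verts G)" by simp
    show "v \<rightarrow>\<^bsub>G\<^esub> u" if "u \<rightarrow>\<^bsub>G\<^esub> v" for u v using that sym_arcs by (auto simp: symmetric_def dest: symD)
    show "\<not> v \<rightarrow>\<^bsub>G\<^esub> v" for v using no_loops by (auto simp: arcs_ends_def arc_to_ends_def)
    show "card {w \<in> verts G. v \<rightarrow>\<^bsub>G\<^esub> w} = r" if "v \<in> verts G" for v
    proof -
      have "{w \<in> verts G. v \<rightarrow>\<^bsub>G\<^esub> w} = head G ` out_arcs G v"
        by (auto simp: arcs_ends_def arc_to_ends_def)
      moreover have "inj_on (head G) (out_arcs G v)"
        using no_multi_arcs by (auto simp: inj_on_def arc_to_ends_def)
      ultimately show ?thesis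
        using assms(2) that by (simp add: regular_graph_def out_degree_def card_image)
    qed
  qed
qed

abbreviation two_complete :: "nat \<Rightarrow> (nat + nat, (nat + nat) \<times> (nat + nat)) pre_digraph" where
  "two_complete k \<equiv> with_proj (disjoint_pgraph_union (complete_pgraph {..<k}) (complete_pgraph {..<k}))"

lemma verts_two_complete: "verts (two_complete k) = {..<k} <+> {..<k}"
  by (simp add: disjoint_pgraph_union_def complete_pgraph_def)

lemma arcs_two_complete:
  "arcs (two_complete k) = {(a, b). a \<in> {..<k} <+> {..<k} \<and> b \<in> {..<k} <+> {..<k} \<and>
     a \<noteq> b \<and> (a \<in> range Inl \<longleftrightarrow> b \<in> range Inl)}"
  by (force simp: disjoint_pgraph_union_def complete_pgraph_def)

text \<open>An isomorphism singles out one clique as the vertices that it sends to the left summand;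
  conversely, bijections of the two cliques with \<open>{..<k}\<close> combine to an isomorphism. As \<open>G\<close> has no
  parallel arcs, mapping an arc to the pair of its mapped ends is injective.\<close>

lemma digraph_iso_two_complete_iff:
  assumes "graph G"
  shows "digraph_iso G (two_complete k) \<longleftrightarrow> two_cliques (verts G) (\<lambda>u v. u \<rightarrow>\<^bsub>G\<^esub> v) k"
proof -
  interpret graph G by fact
  show ?thesis
  proof
    assume "digraph_iso G (two_complete k)"
    then obtain f where f: "digraph_isomorphism f" and H: "two_complete k = app_iso f G"
      by (auto simp: digraph_iso_def)
    define \<phi> where "\<phi> = iso_verts f"
    have inj: "inj_on \<phi> (verts G)" using f by (simp add: digraph_isomorphism_def \<phi>_def)
    have img: "\<phi> ` verts G = {..<k} <+> {..<k}"
      using arg_cong[OF H, of verts] unfolding verts_two_complete by (simp add: \<phi>_def)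
    have "arcs (two_complete k) = (\<lambda>(u, v). (\<phi> u, \<phi> v)) ` arcs_ends G"
      using arcs_ends_app_iso_eq[OF f] by (simp flip: H add: \<phi>_def)
    then have adj: "u \<rightarrow>\<^bsub>G\<^esub> v \<longleftrightarrow> (\<phi> u, \<phi> v) \<in> arcs (two_complete k)" if "u \<in> verts G" "v \<in> verts G" for u v
      using that inj adj_in_verts by (auto simp: inj_on_eq_iff)
    define X where "X = {v \<in> verts G. \<phi> v \<in> range Inl}"
    have "\<phi> ` X = \<phi> ` verts G \<inter> range Inl" by (auto simp: X_def)
    then have "\<phi> ` X = Inl ` {..<k}" unfolding img by auto
    moreover have "\<phi> ` (verts G - X) = \<phi> ` verts G - range Inl" by (auto simp: X_def)
    then have "\<phi> ` (verts G - X) = Inr ` {..<k}" unfolding img by auto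
    moreover have "inj_on \<phi> X" "inj_on \<phi> (verts G - X)" using inj by (auto simp: X_def inj_on_def)
    ultimately have "card X = k" "card (verts G - X) = k"
      by (metis card_image card_lessThan inj_Inl, metis card_image card_lessThan inj_Inr)
    moreover have "u \<rightarrow>\<^bsub>G\<^esub> v \<longleftrightarrow> u \<noteq> v \<and> (u \<in> X \<longleftrightarrow> v \<in> X)" if "u \<in> verts G" "v \<in> verts G" for u v
      unfolding adj[OF that] arcs_two_complete using that img inj
      by (auto simp: X_def inj_on_eq_iff)
    ultimately show "two_cliques (verts G) (\<lambda>u v. u \<rightarrow>\<^bsub>G\<^esub> v) k"
      unfolding two_cliques_def by (intro exI[of _ X]) (auto simp: X_def)
  next
    assume "two_cliques (verts G) (\<lambda>u v. u \<rightarrow>\<^bsub>G\<^esub> v) k"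
    then obtain X where X: "X \<subseteq> verts G" "card X = k" "card (verts G - X) = k"
      and X_adj: "\<forall>u\<in>verts G. \<forall>v\<in>verts G. u \<rightarrow>\<^bsub>G\<^esub> v \<longleftrightarrow> u \<noteq> v \<and> (u \<in> X \<longleftrightarrow> v \<in> X)"
      unfolding two_cliques_def by blast
    have "finite X" using X(1) finite_verts finite_subset by blast
    then obtain g h where g: "bij_betw g X {..<k}" and h: "bij_betw h (verts G - X) {..<k}"
      using X ex_bij_betw_finite_nat[of X] ex_bij_betw_finite_nat[of "verts G - X"]
      by (auto simp: atLeast0LessThan)
    define \<phi> where "\<phi> v = (if v \<in> X then Inl (g v) else Inr (h v))" for v
    have inj: "inj_on \<phi> (verts G)"
      using bij_betw_imp_inj_on[OF g] bij_betw_imp_inj_on[OF h] by (auto simp: inj_on_def \<phi>_def)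
    have "\<phi> ` X = Inl ` g ` X" "\<phi> ` (verts G - X) = Inr ` h ` (verts G - X)"
      by (auto simp: \<phi>_def)
    then have "\<phi> ` X = Inl ` {..<k}" "\<phi> ` (verts G - X) = Inr ` {..<k}"
      by (simp_all only: bij_betw_imp_surj_on[OF g] bij_betw_imp_surj_on[OF h])
    then have img: "\<phi> ` verts G = {..<k} <+> {..<k}"
      using X(1) by (metis Plus_def Un_Diff_cancel image_Un sup.absorb2)
    have inl: "\<phi> v \<in> range Inl \<longleftrightarrow> v \<in> X" for v by (auto simp: \<phi>_def)
    define f where "f = \<lparr>iso_verts = \<phi>, iso_arcs = \<lambda>a. (\<phi> (tail G a), \<phi> (head G a)),
      iso_head = snd, iso_tail = fst\<rparr>"
    have "inj_on (\<lambda>a. (\<phi> (tail G a), \<phi> (head G a))) (arcs G)"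
      using inj no_multi_arcs by (auto simp: inj_on_def arc_to_ends_def)
    then have "digraph_isomorphism f"
      using inj wf_digraph by (auto simp: digraph_isomorphism_def f_def)
    moreover have "two_complete k = app_iso f G"
    proof (rule pre_digraph.equality)
      show "verts (two_complete k) = verts (app_iso f G)"
        by (simp only: verts_two_complete verts_app_iso) (simp add: f_def img)
      have "(\<lambda>a. (\<phi> (tail G a), \<phi> (head G a))) ` arcs G = (\<lambda>(u, v). (\<phi> u, \<phi> v)) ` arcs_ends G"
        by (force simp: arcs_ends_def arc_to_ends_def)
      also have "\<dots> = arcs (two_complete k)"
      proof (intro equalityI subsetI)
        fix e assume "e \<in> (\<lambda>(u, v). (\<phi> u, \<phi> v)) ` arcs_ends G"
        then obtain u v where uv: "u \<rightarrow>\<^bsub>G\<^esub> v" "e = (\<phi> u, \<phi> v)" by auto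
        then have "u \<in> verts G" "v \<in> verts G" by (auto dest: adj_in_verts)
        then show "e \<in> arcs (two_complete k)"
          using uv X_adj inj unfolding arcs_two_complete img[symmetric]
          by (auto simp: inl inj_on_eq_iff)
      next
        fix e assume "e \<in> arcs (two_complete k)"
        then obtain u v where "u \<in> verts G" "v \<in> verts G" "e = (\<phi> u, \<phi> v)" "\<phi> u \<noteq> \<phi> v"
            "\<phi> u \<in> range Inl \<longleftrightarrow> \<phi> v \<in> range Inl"
          unfolding arcs_two_complete img[symmetric] by blast
        then show "e \<in> (\<lambda>(u, v). (\<phi> u, \<phi> v)) ` arcs_ends G"
          using X_adj by (auto simp: inl)
      qed
      finally show "arcs (two_complete k) = arcs (app_iso f G)"
        by (simp add: f_def)
    qed (auto simp: f_def)
    ultimately show "digraph_iso G (two_complete k)" by (auto simp: digraph_iso_def)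
  qed
qed

section \<open>The Seidel energy\<close>

lemma seidel_mat_index:
  assumes "distinct vs" "i < length vs" "j < length vs"
  shows "seidel_mat G vs $$ (i, j) = seidel_sign (\<lambda>u v. u \<rightarrow>\<^bsub>G\<^esub> v) (vs ! i) (vs ! j)"
  using assms by (simp add: seidel_mat_def seidel_sign_def nth_eq_iff_index_eq)

lemma seidel_mat_carrier: "seidel_mat G vs \<in> carrier_mat (length vs) (length vs)"
  by (simp add: seidel_mat_def)

lemma eigenvalue_seidel_mat_iff:
  assumes vs: "distinct vs"
  shows "eigenvalue (seidel_mat G vs) k \<longleftrightarrow>
    (\<exists>x. seidel_eigenvector (set vs) (\<lambda>u v. u \<rightarrow>\<^bsub>G\<^esub> v) k x)"
proof -
  define n where "n = length vs"
  let ?s = "seidel_sign (\<lambda>u v. u \<rightarrow>\<^bsub>G\<^esub> v)"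
  have bij: "bij_betw ((!) vs) {..<n} (set vs)"
    using bij_betw_nth[OF vs, of "{..<n}" "set vs"] by (simp add: n_def)
  have "eigenvalue (seidel_mat G vs) k \<longleftrightarrow>
    (\<exists>x. (\<exists>i<n. x i \<noteq> 0) \<and> (\<forall>i<n. (\<Sum>j<n. ?s (vs ! i) (vs ! j) * x j) = k * x i))"
    using eigenvalue_sum_form[OF seidel_mat_carrier, of G vs k] vs
    by (simp add: n_def[symmetric] seidel_mat_index)
  also have "\<dots> \<longleftrightarrow> (\<exists>x. (\<exists>i<n. x (vs ! i) \<noteq> 0) \<and>
      (\<forall>i<n. (\<Sum>j<n. ?s (vs ! i) (vs ! j) * x (vs ! j)) = k * x (vs ! i)))"
  proof (intro iffI; elim exE)
    fix x assume x: "(\<exists>i<n. x i \<noteq> 0) \<and> (\<forall>i<n. (\<Sum>j<n. ?s (vs ! i) (vs ! j) * x j) = k * x i)"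
    define y where "y v = x (the_inv_into {..<n} ((!) vs) v)" for v
    have y: "y (vs ! i) = x i" if "i < n" for i
      using that the_inv_into_f_f[OF bij_betw_imp_inj_on[OF bij], of i] by (simp add: y_def)
    then have "\<exists>i<n. y (vs ! i) \<noteq> 0" using x by metis
    moreover have "\<forall>i<n. (\<Sum>j<n. ?s (vs ! i) (vs ! j) * y (vs ! j)) = k * y (vs ! i)"
      using x by (simp add: y)
    ultimately show "\<exists>x. (\<exists>i<n. x (vs ! i) \<noteq> 0) \<and>
        (\<forall>i<n. (\<Sum>j<n. ?s (vs ! i) (vs ! j) * x (vs ! j)) = k * x (vs ! i))"
      by blast
  next
    fix x assume "(\<exists>i<n. x (vs ! i) \<noteq> 0) \<and>
        (\<forall>i<n. (\<Sum>j<n. ?s (vs ! i) (vs ! j) * x (vs ! j)) = k * x (vs ! i))"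
    then show "\<exists>x. (\<exists>i<n. x i \<noteq> 0) \<and> (\<forall>i<n. (\<Sum>j<n. ?s (vs ! i) (vs ! j) * x j) = k * x i)"
      by (rule exI[of _ "\<lambda>i. x (vs ! i)"])
  qed
  also have "\<dots> \<longleftrightarrow> (\<exists>x. seidel_eigenvector (set vs) (\<lambda>u v. u \<rightarrow>\<^bsub>G\<^esub> v) k x)"
  proof -
    have "(\<forall>v\<in>set vs. P v) \<longleftrightarrow> (\<forall>i<n. P (vs ! i))" "(\<exists>v\<in>set vs. P v) \<longleftrightarrow> (\<exists>i<n. P (vs ! i))" for P
      unfolding n_def by (metis in_set_conv_nth)+
    then show ?thesis
      by (simp only: seidel_eigenvector_def sum.reindex_bij_betw[OF bij, symmetric])
  qed
  finally show ?thesis .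
qed

lemma seidel_mat_symmetric:
  assumes "graph G" "i < length vs" "j < length vs"
  shows "seidel_mat G vs $$ (j, i) = seidel_mat G vs $$ (i, j)"
proof -
  interpret graph G by fact
  show ?thesis using assms(2,3) by (auto simp: seidel_mat_def intro: graph_symmetric)
qed

lemma mat_trace_seidel_mat: "mat_trace (seidel_mat G vs) = 0"
  by (simp add: mat_trace_def seidel_mat_def)

text \<open>By symmetry each diagonal entry of the square is a sum of squares of one row, and all entries of the
  row except the diagonal one are \<open>\<plusminus>1\<close>.\<close>

lemma mat_trace_seidel_mat_square:
  assumes "graph G"
  shows "mat_trace (seidel_mat G vs * seidel_mat G vs) = real (length vs) * (real (length vs) - 1)"
proof -
  define n where "n = length vs"
  define S where "S = seidel_mat G vs"
  have S: "S \<in> carrier_mat n n" using seidel_mat_carrier by (simp add: S_def n_def)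
  have "(S * S) $$ (i, i) = real n - 1" if i: "i < n" for i
  proof -
    have "(S * S) $$ (i, i) = (\<Sum>l<n. S $$ (i, l) * S $$ (l, i))"
      by (rule index_mult_mat_sum[OF S S i i])
    also have "\<dots> = (\<Sum>l<n. 1 - (if l = i then 1 else 0))"
    proof (intro sum.cong refl)
      fix l assume l: "l \<in> {..<n}"
      then have "S $$ (l, i) = S $$ (i, l)"
        using i seidel_mat_symmetric[OF assms] by (simp add: S_def n_def)
      then show "S $$ (i, l) * S $$ (l, i) = 1 - (if l = i then 1 else 0)"
        using i l by (simp add: S_def seidel_mat_def n_def)
    qed
    also have "\<dots> = real n - 1" using i by (simp add: sum_subtractf)
    finally show ?thesis .
  qed
  then have "mat_trace (S * S) = (\<Sum>i<n. real n - 1)"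
    unfolding mat_trace_def using S by (intro sum.cong) auto
  then show ?thesis by (simp add: S_def n_def)
qed

theorem theorem4p11:
  fixes G :: "('a, 'b) pre_digraph" and vs :: "'a list" and r n :: nat and p :: real
  assumes "r \<ge> 1" and "n = 2 * r + 2" and "p \<ge> 3"
    and "graph G" and "card (verts G) = n" and "regular_graph r G"
    and "distinct vs" and "set vs = verts G"
  shows "p_energy p (seidel_mat G vs) \<le> (real n - 1) powr p + (real n - 1) \<and>
    (p_energy p (seidel_mat G vs) = (real n - 1) powr p + (real n - 1) \<longleftrightarrow>
      digraph_iso G (with_proj (disjoint_pgraph_union
        (complete_pgraph {..<r + 1}) (complete_pgraph {..<r + 1}))))"
proof -
  let ?S = "seidel_mat G vs" and ?adj = "\<lambda>u v. u \<rightarrow>\<^bsub>G\<^esub> v"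
  define M where "M = real n - 1"
  have M: "M = 2 * real r + 1" "M \<ge> 3" using assms(1,2) by (simp_all add: M_def)
  interpret regular_relation "verts G" ?adj r
    using regular_relation_graph assms(4,6) .
  have card: "card (verts G) = 2 * r + 2" using assms(2,5) by simp
  have len: "length vs = n" using assms(5,7,8) distinct_card by metis
  have S: "?S \<in> carrier_mat n n" using seidel_mat_carrier len by metis
  obtain es where split: "char_poly ?S = (\<Prod>e\<leftarrow>es. [:- e, 1:])" and es_len: "length es = n"
    using symmetric_real_char_poly_splits[OF S] seidel_mat_symmetric[OF assms(4)] len by metis
  have es_iff: "e \<in> set es \<longleftrightarrow> (\<exists>x. seidel_eigenvector (verts G) ?adj e x)" for e
  proof -
    have "e \<in> set es \<longleftrightarrow> eigenvalue ?S e"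
      unfolding eigenvalue_root_char_poly[OF S] split
      by (auto simp: poly_prod_list prod_list_zero_iff)
    then show ?thesis using eigenvalue_seidel_mat_iff[OF assms(7)] assms(8) by simp
  qed
  have s1: "sum_list es = 0"
    using trace_eq_sum_eigenvalues(1)[OF S split] mat_trace_seidel_mat by metis
  have s2: "(\<Sum>e\<leftarrow>es. e\<^sup>2) = M\<^sup>2 + M"
    using trace_eq_sum_eigenvalues(2)[OF S split] mat_trace_seidel_mat_square[OF assms(4), of vs] len
    by (simp add: M_def power2_eq_square algebra_simps)
  have range: "- M \<le> e \<and> e \<le> M - 2" if "e \<in> set es" for e
    using that seidel_eigenvalue_range[OF assms(1) card] M(1) by (auto simp: es_iff)
  have es_card: "real (length es) = M + 1" using es_len by (simp add: M_def)
  have energy: "p_energy p ?S = (\<Sum>e\<leftarrow>es. \<bar>e\<bar> powr p)" using p_energy_split[OF split] .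
  note bound = power_sum_bound[OF assms(3) M(2) es_card s1 s2 range, folded energy]
  have "- M \<in> set es \<longleftrightarrow> two_cliques (verts G) ?adj (r + 1)"
    unfolding es_iff M(1)
    using extreme_eigenvector_imp_two_cliques[OF card] two_cliques_imp_extreme_eigenvector[OF card]
    by blast
  then have "- M \<in> set es \<longleftrightarrow> digraph_iso G (two_complete (r + 1))"
    using digraph_iso_two_complete_iff[OF assms(4)] by simp
  then show ?thesis using bound unfolding M_def by simp
qed

end
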